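(* If $(\sigma_1,\sigma_2)$ is an allowable pair of permutations in $\mathfrak{S}_n$, then the directed graph $\mathbf{G}(\sigma_1,\sigma_2)$ has no directed cycle.
   Context: For $\sigma,\gamma\in\mathfrak{S}_n$, the pair $(\sigma,\gamma)$ is allowable if (a) for all $1\le i<j\le n$, $\sigma(i)>\sigma(j)$ implies $\gamma(i)>\gamma(j)$, and (b) for all $1\le i<j<k\le n$ with $\sigma(i)<\sigma(j)<\sigma(k)$, it is not the case that $\gamma(j)<\gamma(k)<\gamma(i)$. For permutations $\sigma_1,\dots,\sigma_k\in\mathfrak{S}_n$, the directed graph $\mathbf{G}(\sigma_1,\dots,\sigma_k)$ has vertex set $\{(i,j):1\le i\le n,\,1\le j\le k\}$ (row $i$, column $j$) and edges: (1) horizontal edges $(i,j)\to(i,j+1)$ for all $1\le i\le n$, $1\le j\le k-1$; (2) vertical edges $(p,j)\to(i,j)$ for all $1\le j\le k$ and $i\ne p$ with $\sigma_j(i)<\sigma_j(p)$; (3) diagonal edges $(p,j)\to(i,j-1)$ for all $2\le j\le k$ and $1\le i<p\le n$ with $\sigma_j(i)<\sigma_j(p)$. *)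

theory Defs
  imports "HOL-Combinatorics.Permutations" "Graph_Theory.Arc_Walk"
begin

definition allowable :: "nat \<Rightarrow> (nat \<Rightarrow> nat) \<Rightarrow> (nat \<Rightarrow> nat) \<Rightarrow> bool" where
  "allowable n \<sigma> \<gamma> \<longleftrightarrow>
     (\<forall>i j. 1 \<le> i \<and> i < j \<and> j \<le> n \<and> \<sigma> i > \<sigma> j \<longrightarrow> \<gamma> i > \<gamma> j) \<and>
     (\<forall>i j k. 1 \<le> i \<and> i < j \<and> j < k \<and> k \<le> n \<and> \<sigma> i < \<sigma> j \<and> \<sigma> j < \<sigma> k \<longrightarrow>
        \<not> (\<gamma> j < \<gamma> k \<and> \<gamma> k < \<gamma> i))"

type_synonym vertex = "nat \<times> nat"
type_synonym edge = "vertex \<times> vertex"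

text \<open>
  In the following, the vertex \<open>(i, j)\<close> is in row \<open>i\<close> and column \<open>j\<close>, both counted from 1.
  The list \<open>\<sigma>s\<close> is indexed from 0, so the permutation of column \<open>j\<close> is \<open>\<sigma>s ! (j - 1)\<close>.
\<close>

definition horizontal_edges :: "nat \<Rightarrow> (nat \<Rightarrow> nat) list \<Rightarrow> edge set" where
  "horizontal_edges n \<sigma>s =
     {((i, j), (i, j + 1)) | i j. 1 \<le> i \<and> i \<le> n \<and> 1 \<le> j \<and> j + 1 \<le> length \<sigma>s}"

definition vertical_edges :: "nat \<Rightarrow> (nat \<Rightarrow> nat) list \<Rightarrow> edge set" where
  "vertical_edges n \<sigma>s =
     {((p, j), (i, j)) | p i j. p \<in> {1..n} \<and> i \<in> {1..n} \<and> 1 \<le> j \<and> j \<le> length \<sigma>s \<and>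
        i \<noteq> p \<and> (\<sigma>s ! (j - 1)) i < (\<sigma>s ! (j - 1)) p}"

definition diagonal_edges :: "nat \<Rightarrow> (nat \<Rightarrow> nat) list \<Rightarrow> edge set" where
  "diagonal_edges n \<sigma>s =
     {((p, j), (i, j - 1)) | p i j. 2 \<le> j \<and> j \<le> length \<sigma>s \<and> 1 \<le> i \<and> i < p \<and> p \<le> n \<and>
        (\<sigma>s ! (j - 1)) i < (\<sigma>s ! (j - 1)) p}"

definition perm_graph :: "nat \<Rightarrow> (nat \<Rightarrow> nat) list \<Rightarrow> (vertex, edge) pre_digraph" where
  "perm_graph n \<sigma>s =
     \<lparr>verts = {1..n} \<times> {1..length \<sigma>s},
      arcs = horizontal_edges n \<sigma>s \<union> vertical_edges n \<sigma>s \<union> diagonal_edges n \<sigma>s,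
      tail = fst, head = snd\<rparr>"

lemma wf_digraph_perm_graph: "wf_digraph (perm_graph n \<sigma>s)"
  by unfold_locales
    (auto simp: perm_graph_def horizontal_edges_def vertical_edges_def diagonal_edges_def)

end

theory Submission
  imports Defs "HOL-Library.Product_Lexorder"
begin

text \<open>
  Every edge strictly decreases a potential with values in pairs, ordered lexicographically.
  A vertex \<open>(i, 1)\<close> gets \<open>(\<sigma>\<^sub>1 i, 0)\<close>, and \<open>(c, 2)\<close> gets \<open>(M c, \<sigma>\<^sub>2 c)\<close>, where \<open>M c\<close> is the
  largest \<open>\<sigma>\<^sub>1 a\<close> for which \<open>(a, 1)\<close> can be reached from \<open>(c, 2)\<close> by vertical edges followed by one
  diagonal edge. Allowability is what makes the horizontal edge at \<open>c\<close> strictly decreasing, that is,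
  \<open>M c < \<sigma>\<^sub>1 c\<close>.
\<close>

text \<open>By transitivity \<open>f\<close> drops along every nonempty walk, so a closed one would
  give \<open>f u < f u\<close>.\<close>

lemma (in wf_digraph) no_cycle_if_decreasing:
  fixes f :: "'a \<Rightarrow> 'c::order"
  assumes "\<And>e. e \<in> arcs G \<Longrightarrow> f (head G e) < f (tail G e)"
  shows "\<nexists>c. cycle c"
proof
  assume "\<exists>c. cycle c"
  then obtain u where "u \<rightarrow>\<^sup>+ u"
    unfolding cycle_def by (blast intro: reachable1_awalkI)
  moreover have "f v < f u" if "u \<rightarrow>\<^sup>+ v" for u v
    using that
  proof (induction rule: trancl_induct)
    case (base v)
    then show ?case using assms by (auto simp: arcs_ends_def arc_to_ends_def)
  next
    case (step v w)
    then show ?case using assms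
      by (auto simp: arcs_ends_def arc_to_ends_def intro: less_trans)
  qed
  ultimately show False by blast
qed

text \<open>If instead \<open>\<sigma> b < \<sigma> a\<close>, the inversion condition forces
  \<open>b < a\<close> and \<open>\<sigma> a < \<sigma> c\<close>, so the rows
  \<open>b < a < c\<close> carry the pattern excluded by the second condition.\<close>

lemma allowable_descent:
  assumes "allowable n \<sigma> \<gamma>" and inj: "inj_on \<sigma> {1..n}" and "inj_on \<gamma> {1..n}"
    and rows: "a \<in> {1..n}" "b \<in> {1..n}" "c \<in> {1..n}"
    and "\<gamma> c \<le> \<gamma> b" "a < c" "\<gamma> a < \<gamma> c"
  shows "\<sigma> a < \<sigma> b"
proof (rule ccontr)
  assume "\<not> \<sigma> a < \<sigma> b"
  have inversion: "\<gamma> j < \<gamma> i" if "1 \<le> i" "i < j" "j \<le> n" "\<sigma> j < \<sigma> i" for i j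
    using assms(1) that unfolding allowable_def by blast
  have "a \<noteq> b" using assms by auto
  with \<open>\<not> \<sigma> a < \<sigma> b\<close> have "\<sigma> b < \<sigma> a"
    using inj_onD[OF inj] rows by (metis linorder_neqE_nat)
  moreover from this have "b < a"
    using inversion[of a b] \<open>a \<noteq> b\<close> assms by (cases a b rule: linorder_cases) auto
  moreover have "\<sigma> a < \<sigma> c"
    using inversion[of a c] inj_onD[OF inj, of a c] assms
    by (cases "\<sigma> a" "\<sigma> c" rule: linorder_cases) auto
  \<comment> \<open>Equality is impossible: \<open>b < a < c\<close> makes the two rows distinct and
    \<open>\<gamma>\<close> is injective.\<close>
  moreover have "\<gamma> c < \<gamma> b"
    using \<open>b < a\<close> \<open>a < c\<close> \<open>\<gamma> c \<le> \<gamma> b\<close> rows inj_onD[OF \<open>inj_on \<gamma> {1..n}\<close>, of c b]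
    by (cases "\<gamma> c = \<gamma> b") auto
  ultimately show False
    using assms unfolding allowable_def by auto
qed

text \<open>Vertical edges compose by transitivity, so one comparison of \<open>c'\<close> with
  \<open>c\<close> covers every vertical path; \<open>\<le>\<close> admits the empty path,
  \<open>c' = c\<close>.\<close>

definition diagonal_targets :: "nat \<Rightarrow> (nat \<Rightarrow> nat) \<Rightarrow> nat \<Rightarrow> nat set" where
  "diagonal_targets n \<gamma> c =
     {a. \<exists>c'. 1 \<le> a \<and> a < c' \<and> c' \<le> n \<and> \<gamma> c' \<le> \<gamma> c \<and> \<gamma> a < \<gamma> c'}"

lemma finite_diagonal_targets: "finite (diagonal_targets n \<gamma> c)"
  by (rule finite_subset[of _ "{1..n}"]) (auto simp: diagonal_targets_def)

text \<open>The inserted 0 gives \<open>Max\<close> a value when there is no target.\<close>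

definition highest_target :: "nat \<Rightarrow> (nat \<Rightarrow> nat) \<Rightarrow> (nat \<Rightarrow> nat) \<Rightarrow> nat \<Rightarrow> nat" where
  "highest_target n \<sigma> \<gamma> c = Max (insert 0 (\<sigma> ` diagonal_targets n \<gamma> c))"

lemma le_highest_target: "a \<in> diagonal_targets n \<gamma> c \<Longrightarrow> \<sigma> a \<le> highest_target n \<sigma> \<gamma> c"
  unfolding highest_target_def by (intro Max_ge) (auto simp: finite_diagonal_targets)

text \<open>Any intermediate row \<open>c'\<close> that serves for \<open>c\<close> also serves for
  \<open>d\<close>.\<close>

lemma highest_target_mono:
  assumes "\<gamma> c \<le> \<gamma> d"
  shows "highest_target n \<sigma> \<gamma> c \<le> highest_target n \<sigma> \<gamma> d"
proof -
  have "diagonal_targets n \<gamma> c \<subseteq> diagonal_targets n \<gamma> d"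
    using assms by (fastforce simp: diagonal_targets_def)
  then show ?thesis
    unfolding highest_target_def by (intro Max_mono) (auto simp: finite_diagonal_targets)
qed

definition potential :: "nat \<Rightarrow> (nat \<Rightarrow> nat) \<Rightarrow> (nat \<Rightarrow> nat) \<Rightarrow> vertex \<Rightarrow> nat \<times> nat" where
  "potential n \<sigma> \<gamma> = (\<lambda>(i, j). if j = 1 then (\<sigma> i, 0) else (highest_target n \<sigma> \<gamma> i, \<gamma> i))"

theorem theorem5p4:
  fixes n :: nat and \<sigma>\<^sub>1 \<sigma>\<^sub>2 :: "nat \<Rightarrow> nat"
  assumes "\<sigma>\<^sub>1 permutes {1..n}" and "\<sigma>\<^sub>2 permutes {1..n}"
    and "allowable n \<sigma>\<^sub>1 \<sigma>\<^sub>2"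
  shows "\<nexists>c. pre_digraph.cycle (perm_graph n [\<sigma>\<^sub>1, \<sigma>\<^sub>2]) c"
proof (rule wf_digraph.no_cycle_if_decreasing[OF wf_digraph_perm_graph])
  let ?G = "perm_graph n [\<sigma>\<^sub>1, \<sigma>\<^sub>2]"
  let ?f = "potential n \<sigma>\<^sub>1 \<sigma>\<^sub>2"
  \<comment> \<open>The first bound puts the default 0 of \<open>highest_target\<close> below
    \<open>\<sigma>\<^sub>1 i\<close>; the second breaks ties on diagonal edges.\<close>
  have pos: "0 < \<sigma>\<^sub>1 i" "0 < \<sigma>\<^sub>2 i" if "i \<in> {1..n}" for i
    using permutes_in_image[OF assms(1), of i] permutes_in_image[OF assms(2), of i] that by auto
  have descent: "highest_target n \<sigma>\<^sub>1 \<sigma>\<^sub>2 i < \<sigma>\<^sub>1 i" if "i \<in> {1..n}" for i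
  proof -
    have "\<sigma>\<^sub>1 a < \<sigma>\<^sub>1 i" if a: "a \<in> diagonal_targets n \<sigma>\<^sub>2 i" for a
    proof -
      from a obtain c where "a \<in> {1..n}" "c \<in> {1..n}" "\<sigma>\<^sub>2 c \<le> \<sigma>\<^sub>2 i" "a < c" "\<sigma>\<^sub>2 a < \<sigma>\<^sub>2 c"
        by (auto simp: diagonal_targets_def)
      with \<open>i \<in> {1..n}\<close> show ?thesis
        by (intro allowable_descent[OF assms(3) permutes_inj_on[OF assms(1)] permutes_inj_on[OF assms(2)]])
    qed
    with pos that show ?thesis
      unfolding highest_target_def by (auto simp: finite_diagonal_targets)
  qed
  fix e assume "e \<in> arcs ?G"
  then consider
      (horizontal) i where "e = ((i, 1), (i, 2))" "i \<in> {1..n}"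
    | (vertical1) p i where "e = ((p, 1), (i, 1))" "\<sigma>\<^sub>1 i < \<sigma>\<^sub>1 p"
    | (vertical2) p i where "e = ((p, 2), (i, 2))" "\<sigma>\<^sub>2 i < \<sigma>\<^sub>2 p"
    | (diagonal) p i where "e = ((p, 2), (i, 1))" "1 \<le> i" "i < p" "p \<le> n" "\<sigma>\<^sub>2 i < \<sigma>\<^sub>2 p"
    by (auto simp: perm_graph_def horizontal_edges_def vertical_edges_def diagonal_edges_def
        less_Suc_eq numeral_2_eq_2 le_Suc_eq)
  then show "?f (head ?G e) < ?f (tail ?G e)"
  proof cases
    case horizontal
    then show ?thesis using descent by (auto simp: potential_def perm_graph_def)
  next
    case vertical1
    then show ?thesis by (auto simp: potential_def perm_graph_def)
  next
    case vertical2
    then show ?thesis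
      \<comment> \<open>The first component may stay equal here; then the second one,
        \<open>\<sigma>\<^sub>2\<close>, drops.\<close>
      using highest_target_mono[of \<sigma>\<^sub>2 i p n \<sigma>\<^sub>1] by (auto simp: potential_def perm_graph_def)
  next
    case diagonal
    then have "i \<in> diagonal_targets n \<sigma>\<^sub>2 p"
      by (auto simp: diagonal_targets_def)
    with diagonal show ?thesis
      \<comment> \<open>If \<open>i\<close> attains the maximum, the first components tie and the
        second drops from \<open>\<sigma>\<^sub>2 p\<close> to 0.\<close>
      using le_highest_target[of i n \<sigma>\<^sub>2 p \<sigma>\<^sub>1] pos(2)[of p]
      by (auto simp: potential_def perm_graph_def less_eq_prod_def)
  qed
qed

end
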